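(* Let $X$ be a regular paraLindelöf space and let $n\geq 1$ be an integer. Then the following are equivalent: (i) $X$ is $n$-star-Menger; (ii) $X$ is strongly $n$-star-Menger; (iii) $X$ is Menger.
   Context: Regular spaces are assumed to be $T_1$. A space is paraLindelöf if every open cover has a locally countable open refinement (each point has a neighbourhood meeting at most countably many members). For a family $\mathcal{U}$ of subsets of $X$ and $A\subseteq X$, $St(A,\mathcal{U})=St^1(A,\mathcal{U})=\bigcup\{U\in\mathcal{U}: U\cap A\neq\emptyset\}$ and $St^{n+1}(A,\mathcal{U})=St(St^n(A,\mathcal{U}),\mathcal{U})$ for $n\ge 1$. $X$ is Menger if for each sequence $\{\mathcal{U}_n:n\in\omega\}$ of open covers of $X$ there are finite $\mathcal{V}_n\subseteq\mathcal{U}_n$ such that $\{\bigcup\mathcal{V}_n:n\in\omega\}$ covers $X$. For an integer $k\geq1$, $X$ is $k$-star-Menger if for each sequence $\{\mathcal{U}_n:n\in\omega\}$ of open covers of $X$ there are finite $\mathcal{V}_n\subseteq\mathcal{U}_n$ such that $\{St^k(\bigcup\mathcal{V}_n,\mathcal{U}_n):n\in\omega\}$ covers $X$; $X$ is strongly $k$-star-Menger if for each such sequence there are finite $F_n\subseteq X$ such that $\{St^k(F_n,\mathcal{U}_n):n\in\omega\}$ covers $X$. *)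

theory Defs
  imports "HOL-Analysis.Analysis"
begin

definition open_cover :: "'a topology \<Rightarrow> 'a set set \<Rightarrow> bool" where
  "open_cover X \<U> \<longleftrightarrow> (\<forall>U\<in>\<U>. openin X U) \<and> \<Union>\<U> = topspace X"

definition locally_countable_in :: "'a topology \<Rightarrow> 'a set set \<Rightarrow> bool" where
  "locally_countable_in X \<A> \<longleftrightarrow>
     \<Union>\<A> \<subseteq> topspace X \<and>
     (\<forall>x\<in>topspace X. \<exists>W. openin X W \<and> x \<in> W \<and> countable {A\<in>\<A>. A \<inter> W \<noteq> {}})"

(* A refinement of a cover is itself required to be a cover. *)
definition paraLindelof_space :: "'a topology \<Rightarrow> bool" where
  "paraLindelof_space X \<longleftrightarrow>
     (\<forall>\<U>. open_cover X \<U> \<longrightarrow>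
       (\<exists>\<V>. open_cover X \<V> \<and> (\<forall>V\<in>\<V>. \<exists>U\<in>\<U>. V \<subseteq> U) \<and> locally_countable_in X \<V>))"

definition St :: "'a set set \<Rightarrow> 'a set \<Rightarrow> 'a set" where
  "St \<U> A = \<Union>{U\<in>\<U>. U \<inter> A \<noteq> {}}"

(* The k-fold star of A is the iterate (St \<U> ^^ k) A. For k = 0 this is A itself; the
   star-Menger notions below are meant for k \<ge> 1 only. *)

definition Menger_space :: "'a topology \<Rightarrow> bool" where
  "Menger_space X \<longleftrightarrow>
     (\<forall>\<U> :: nat \<Rightarrow> 'a set set. (\<forall>n. open_cover X (\<U> n)) \<longrightarrow>
       (\<exists>\<V>. (\<forall>n. finite (\<V> n) \<and> \<V> n \<subseteq> \<U> n) \<and>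
            (\<Union>n. \<Union>(\<V> n)) = topspace X))"

definition star_Menger_space :: "nat \<Rightarrow> 'a topology \<Rightarrow> bool" where
  "star_Menger_space k X \<longleftrightarrow>
     (\<forall>\<U> :: nat \<Rightarrow> 'a set set. (\<forall>n. open_cover X (\<U> n)) \<longrightarrow>
       (\<exists>\<V>. (\<forall>n. finite (\<V> n) \<and> \<V> n \<subseteq> \<U> n) \<and>
            (\<Union>n. (St (\<U> n) ^^ k) (\<Union>(\<V> n))) = topspace X))"

definition strongly_star_Menger_space :: "nat \<Rightarrow> 'a topology \<Rightarrow> bool" where
  "strongly_star_Menger_space k X \<longleftrightarrow>
     (\<forall>\<U> :: nat \<Rightarrow> 'a set set. (\<forall>n. open_cover X (\<U> n)) \<longrightarrow>
       (\<exists>F. (\<forall>n. finite (F n) \<and> F n \<subseteq> topspace X) \<and>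
            (\<Union>n. (St (\<U> n) ^^ k) (F n)) = topspace X))"

end

theory Submission
  imports Defs
begin

text \<open>
  A Menger space selects finite subfamilies that already cover, so choosing a point in each
  selected set, or a member around each selected point, passes from Menger to strongly
  \<open>n\<close>-star-Menger and on to \<open>n\<close>-star-Menger. The content is the way back: an
  \<open>n\<close>-fold star must be absorbed into few members of a given cover \<open>\<U>\<close>. This is done by
  replacing \<open>\<U>\<close> with a finer cover whose \<open>n\<close>-fold stars are under control, once for
  ``few'' meaning countably many and once for ``few'' meaning finitely many. In both cases it
  is enough to control a single star, since a chain of \<open>n\<close> successive refinements then
  controls the \<open>n\<close>-fold one (\<open>iterated_stars_under_small_unions\<close>).

  Countable control comes from the paraLindelof property: take a locally countable open
  refinement and pass to open sets that meet only countably many of its members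
  (\<open>paraLindelof_countable_star_refinement\<close>). Applied to a constant sequence of covers,
  the \<open>n\<close>-star-Menger property then yields countable subcovers, so the space is Lindelof.

  Finite control now comes from regularity. A regular Lindelof space is completely regular, so
  every open cover is refined by a countable cover consisting of cozero sets. Scaling the
  corresponding functions by \<open>(1/2)^i\<close> defines a pseudometric with open balls, in which star
  refinements are given by balls whose radii are small compared with a Lebesgue number at their
  centre (\<open>star_refinement_of_vanishing_functions\<close>). Applying the \<open>n\<close>-star-Menger
  property to the resulting fine covers yields finite selections from the original ones.
\<close>

section \<open>Stars of open covers\<close>

lemma St_mono: "A \<subseteq> B \<Longrightarrow> St \<U> A \<subseteq> St \<U> B"
  unfolding St_def by blast

lemma St_Union: "St \<U> (\<Union>\<C>) = (\<Union>C\<in>\<C>. St \<U> C)"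
  unfolding St_def by blast

lemma St_refine: "(\<And>V. V \<in> \<V> \<Longrightarrow> \<exists>U\<in>\<U>. V \<subseteq> U) \<Longrightarrow> St \<V> A \<subseteq> St \<U> A"
  unfolding St_def by blast

lemma funpow_St_mono: "A \<subseteq> B \<Longrightarrow> (St \<U> ^^ k) A \<subseteq> (St \<U> ^^ k) B"
  by (induction k) (simp_all add: St_mono)

lemma funpow_St_refine:
  assumes "\<And>V. V \<in> \<V> \<Longrightarrow> \<exists>U\<in>\<U>. V \<subseteq> U"
  shows "(St \<V> ^^ k) A \<subseteq> (St \<U> ^^ k) A"
proof (induction k)
  case (Suc k)
  then show ?case
    using St_mono[OF Suc, of \<V>] St_refine[of \<V> \<U>, OF assms] by fastforce
qed simp

lemma open_cover_subset_topspace: "open_cover X \<U> \<Longrightarrow> \<V> \<subseteq> \<U> \<Longrightarrow> \<Union>\<V> \<subseteq> topspace X"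
  unfolding open_cover_def by blast

lemma subset_St: "open_cover X \<U> \<Longrightarrow> A \<subseteq> topspace X \<Longrightarrow> A \<subseteq> St \<U> A"
  unfolding open_cover_def St_def by blast

lemma St_subset_topspace: "open_cover X \<U> \<Longrightarrow> St \<U> A \<subseteq> topspace X"
  unfolding open_cover_def St_def by blast

lemma funpow_St_subset_topspace:
  assumes "open_cover X \<U>" "A \<subseteq> topspace X"
  shows "(St \<U> ^^ k) A \<subseteq> topspace X"
  by (cases k) (use assms St_subset_topspace[OF assms(1)] in auto)

lemma St_subset_funpow_St:
  assumes "open_cover X \<U>" "A \<subseteq> topspace X" "k \<ge> 1"
  shows "St \<U> A \<subseteq> (St \<U> ^^ k) A"
  using assms(3)
proof (induction k rule: dec_induct)
  case (step k)
  have "(St \<U> ^^ k) A \<subseteq> St \<U> ((St \<U> ^^ k) A)"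
    by (rule subset_St[OF assms(1) funpow_St_subset_topspace[OF assms(1,2)]])
  then show ?case using step by auto
qed simp

section \<open>Iterating a star property of open covers\<close>

text \<open>
  If \<open>\<V>\<close> refines \<open>\<W>\<close> and the first star with respect to \<open>\<V>\<close> stays inside few
  members of \<open>\<W>\<close>, then the other \<open>k\<close> stars may be taken with respect to the coarser
  \<open>\<W>\<close>, which is where the induction hypothesis applies. The predicate \<open>small\<close> will be
  instantiated to \<open>countable\<close> and to \<open>finite\<close>.
\<close>

lemma iterated_stars_under_small_unions:
  fixes small :: "'a set set \<Rightarrow> bool"
  assumes step: "\<And>\<U>. open_cover X \<U> \<Longrightarrow>
      \<exists>\<V>. open_cover X \<V> \<and> (\<forall>V\<in>\<V>. \<exists>U\<in>\<U>. V \<subseteq> U) \<and>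
        (\<forall>\<C>\<subseteq>\<V>. small \<C> \<longrightarrow> (\<exists>\<D>\<subseteq>\<U>. small \<D> \<and> St \<V> (\<Union>\<C>) \<subseteq> \<Union>\<D>))"
    and cover: "open_cover X \<U>"
  shows "\<exists>\<V>. open_cover X \<V> \<and>
        (\<forall>\<C>\<subseteq>\<V>. small \<C> \<longrightarrow> (\<exists>\<D>\<subseteq>\<U>. small \<D> \<and> (St \<V> ^^ k) (\<Union>\<C>) \<subseteq> \<Union>\<D>))"
proof (induction k)
  case 0
  then show ?case using cover by auto
next
  case (Suc k)
  then obtain \<W> where W: "open_cover X \<W>"
    and star_W: "\<And>\<C>. \<C> \<subseteq> \<W> \<Longrightarrow> small \<C> \<Longrightarrow> \<exists>\<D>\<subseteq>\<U>. small \<D> \<and> (St \<W> ^^ k) (\<Union>\<C>) \<subseteq> \<Union>\<D>"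
    by blast
  from step[OF W] obtain \<V> where V: "open_cover X \<V>"
    and refines: "\<And>V. V \<in> \<V> \<Longrightarrow> \<exists>W\<in>\<W>. V \<subseteq> W"
    and star_V: "\<And>\<C>. \<C> \<subseteq> \<V> \<Longrightarrow> small \<C> \<Longrightarrow> \<exists>\<D>\<subseteq>\<W>. small \<D> \<and> St \<V> (\<Union>\<C>) \<subseteq> \<Union>\<D>"
    by auto
  have star: "\<exists>\<D>\<subseteq>\<U>. small \<D> \<and> (St \<V> ^^ Suc k) (\<Union>\<C>) \<subseteq> \<Union>\<D>"
    if C: "\<C> \<subseteq> \<V>" "small \<C>" for \<C>
  proof -
    obtain \<E> where "\<E> \<subseteq> \<W>" "small \<E>" and E: "St \<V> (\<Union>\<C>) \<subseteq> \<Union>\<E>"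
      using star_V[OF C] by blast
    then obtain \<D> where D: "\<D> \<subseteq> \<U>" "small \<D>" "(St \<W> ^^ k) (\<Union>\<E>) \<subseteq> \<Union>\<D>"
      using star_W[of \<E>] by blast
    have "(St \<V> ^^ Suc k) (\<Union>\<C>) = (St \<V> ^^ k) (St \<V> (\<Union>\<C>))"
      by (simp only: funpow_Suc_right o_apply)
    also have "\<dots> \<subseteq> (St \<V> ^^ k) (\<Union>\<E>)"
      by (rule funpow_St_mono[OF E])
    also have "\<dots> \<subseteq> (St \<W> ^^ k) (\<Union>\<E>)"
      by (rule funpow_St_refine[OF refines])
    finally have "(St \<V> ^^ Suc k) (\<Union>\<C>) \<subseteq> \<Union>\<D>"
      using D(3) by (rule subset_trans)
    then show ?thesis using D(1,2) by (intro exI[of _ \<D>] conjI)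
  qed
  show ?case
    by (rule exI[of _ \<V>], intro conjI allI impI, rule V, rule star)
qed

section \<open>Countable stars and the Lindelof property\<close>

text \<open>
  Let \<open>\<W>\<close> be a locally countable open refinement of \<open>\<U>\<close>, and let \<open>\<V>\<close> consist of
  the open sets that lie inside some member of \<open>\<W>\<close> and meet only countably many of them. A
  set \<open>C\<close> in \<open>\<V>\<close> may meet uncountably many members of \<open>\<V>\<close>, but each of these lies in
  one of the countably many members of \<open>\<W>\<close> that meet \<open>C\<close>.
\<close>

lemma paraLindelof_countable_star_refinement:
  assumes "paraLindelof_space X" and "open_cover X \<U>"
  shows "\<exists>\<V>. open_cover X \<V> \<and> (\<forall>V\<in>\<V>. \<exists>U\<in>\<U>. V \<subseteq> U) \<and>
           (\<forall>\<C>\<subseteq>\<V>. countable \<C> \<longrightarrow> (\<exists>\<D>\<subseteq>\<U>. countable \<D> \<and> St \<V> (\<Union>\<C>) \<subseteq> \<Union>\<D>))"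
proof -
  obtain \<W> where W: "open_cover X \<W>" "\<forall>W\<in>\<W>. \<exists>U\<in>\<U>. W \<subseteq> U" "locally_countable_in X \<W>"
    using assms unfolding paraLindelof_space_def by meson
  then obtain enlarge where enlarge: "\<And>W. W \<in> \<W> \<Longrightarrow> enlarge W \<in> \<U> \<and> W \<subseteq> enlarge W"
    by metis
  define meets where "meets V = {W\<in>\<W>. W \<inter> V \<noteq> {}}" for V
  define \<V> where "\<V> = {V. openin X V \<and> (\<exists>W\<in>\<W>. V \<subseteq> W) \<and> countable (meets V)}"
  have "topspace X \<subseteq> \<Union>\<V>"
  proof
    fix x assume x: "x \<in> topspace X"
    then obtain W where W1: "W \<in> \<W>" "x \<in> W" "openin X W"
      using W(1) unfolding open_cover_def by blast
    obtain N where N: "openin X N" "x \<in> N" "countable (meets N)"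
      using W(3) x unfolding locally_countable_in_def meets_def by blast
    have "countable (meets (W \<inter> N))"
      by (rule countable_subset[OF _ N(3)]) (auto simp: meets_def)
    then have "W \<inter> N \<in> \<V>"
      using W1 N by (auto simp: \<V>_def)
    then show "x \<in> \<Union>\<V>" using W1 N by blast
  qed
  moreover have "\<forall>V\<in>\<V>. openin X V"
    by (simp add: \<V>_def)
  ultimately have "open_cover X \<V>"
    unfolding open_cover_def by (meson Sup_least openin_subset subset_antisym)
  moreover have "\<forall>V\<in>\<V>. \<exists>U\<in>\<U>. V \<subseteq> U"
    using enlarge unfolding \<V>_def by blast
  moreover have "\<exists>\<D>\<subseteq>\<U>. countable \<D> \<and> St \<V> (\<Union>\<C>) \<subseteq> \<Union>\<D>"
    if C: "\<C> \<subseteq> \<V>" "countable \<C>" for \<C>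
  proof (intro exI conjI)
    show "enlarge ` (\<Union>(meets ` \<C>)) \<subseteq> \<U>"
      using enlarge by (auto simp: meets_def)
    show "countable (enlarge ` (\<Union>(meets ` \<C>)))"
      using C by (auto simp: \<V>_def)
    show "St \<V> (\<Union>\<C>) \<subseteq> \<Union>(enlarge ` (\<Union>(meets ` \<C>)))"
    proof
      fix z assume "z \<in> St \<V> (\<Union>\<C>)"
      then obtain V C where V: "V \<in> \<V>" "z \<in> V" "C \<in> \<C>" "V \<inter> C \<noteq> {}"
        unfolding St_def by blast
      then obtain W where W1: "W \<in> \<W>" "V \<subseteq> W" unfolding \<V>_def by blast
      then have "W \<in> meets C" using V unfolding meets_def by blast
      then show "z \<in> \<Union>(enlarge ` (\<Union>(meets ` \<C>)))"
        using enlarge[OF W1(1)] W1 V by blast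
    qed
  qed
  ultimately show ?thesis by blast
qed

text \<open>
  A constant sequence of covers is enough here: the selected finite families are together only
  countable, and each of their \<open>n\<close>-fold stars is covered by countably many members of the
  original cover.
\<close>

lemma paraLindelof_star_Menger_imp_Lindelof:
  assumes "paraLindelof_space X" and "star_Menger_space n X"
  shows "Lindelof_space X"
  unfolding Lindelof_space_def
proof (intro allI impI)
  fix \<U> :: "'a set set"
  assume "(\<forall>U\<in>\<U>. openin X U) \<and> \<Union>\<U> = topspace X"
  then have U: "open_cover X \<U>" by (simp add: open_cover_def)
  obtain \<V> where V: "open_cover X \<V>"
    and star: "\<And>\<C>. \<C> \<subseteq> \<V> \<Longrightarrow> countable \<C> \<Longrightarrow> \<exists>\<D>\<subseteq>\<U>. countable \<D> \<and> (St \<V> ^^ n) (\<Union>\<C>) \<subseteq> \<Union>\<D>"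
    using iterated_stars_under_small_unions
      [OF paraLindelof_countable_star_refinement[OF assms(1)] U, where k = n] by blast
  obtain \<F> where F: "\<And>m::nat. finite (\<F> m) \<and> \<F> m \<subseteq> \<V>"
    and cover: "(\<Union>m. (St \<V> ^^ n) (\<Union>(\<F> m))) = topspace X"
    using assms(2)[unfolded star_Menger_space_def, rule_format, of "\<lambda>_. \<V>"] V by blast
  have "\<forall>m. \<exists>\<D>\<subseteq>\<U>. countable \<D> \<and> (St \<V> ^^ n) (\<Union>(\<F> m)) \<subseteq> \<Union>\<D>"
    using star[OF conjunct2[OF F] countable_finite[OF conjunct1[OF F]]] by blast
  then obtain \<D> where D: "\<And>m. \<D> m \<subseteq> \<U> \<and> countable (\<D> m) \<and> (St \<V> ^^ n) (\<Union>(\<F> m)) \<subseteq> \<Union>(\<D> m)"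
    by metis
  have "countable (\<Union>m. \<D> m)" "(\<Union>m. \<D> m) \<subseteq> \<U>"
    using D by auto
  moreover have "\<Union>(\<Union>m. \<D> m) = topspace X"
  proof
    show "\<Union>(\<Union>m. \<D> m) \<subseteq> topspace X"
      by (rule open_cover_subset_topspace[OF U]) (use D in auto)
    have "(St \<V> ^^ n) (\<Union>(\<F> m)) \<subseteq> \<Union>(\<Union>m. \<D> m)" for m
      using D[of m] by blast
    then show "topspace X \<subseteq> \<Union>(\<Union>m. \<D> m)"
      unfolding cover[symmetric] by (rule UN_least)
  qed
  ultimately show "\<exists>\<V>. countable \<V> \<and> \<V> \<subseteq> \<U> \<and> \<Union>\<V> = topspace X"
    by blast
qed

section \<open>Star refinements in regular Lindelof spaces\<close>

text \<open>
  The functions \<open>g i\<close> induce the pseudometric \<open>d x y = (SUP i. \<bar>g i x - g i y\<bar>)\<close>.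
  Because they tend to \<open>0\<close> uniformly, only finitely many of them matter for a given radius,
  which makes balls open, and the supremum of the \<open>g i x\<close> over \<open>i\<close> is attained at some
  ``leading'' index. The leading value at \<open>x\<close> is a 1-Lipschitz function of \<open>x\<close>, and the
  ball of that radius around \<open>x\<close> lies in the cozero set of the leading function. Balls of an
  eighth of that radius therefore have comparable size when they meet, and the star of one of
  them stays inside the cozero set belonging to its centre.
\<close>

lemma star_refinement_of_vanishing_functions:
  fixes g :: "nat \<Rightarrow> 'a \<Rightarrow> real"
  assumes cont: "\<And>i. continuous_map X euclideanreal (g i)"
    and bound: "\<And>i x. x \<in> topspace X \<Longrightarrow> 0 \<le> g i x \<and> g i x \<le> (1/2) ^ i"
    and pos: "\<And>x. x \<in> topspace X \<Longrightarrow> \<exists>i. 0 < g i x"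
  obtains \<V> where "open_cover X \<V>"
    and "\<And>V. V \<in> \<V> \<Longrightarrow> \<exists>i. St \<V> V \<subseteq> {x \<in> topspace X. 0 < g i x}"
proof -
  define B where "B x e = {y \<in> topspace X. \<forall>i. \<bar>g i y - g i x\<bar> < e}" for x e
  define leading where "leading i x \<longleftrightarrow> 0 < g i x \<and> (\<forall>j. g j x \<le> g i x)" for i x
  define \<V> where "\<V> = {B x (g i x / 8) |i x. x \<in> topspace X \<and> leading i x}"
  have small_tail: "\<exists>N. \<forall>i\<ge>N. (1/2) ^ i < e" if "0 < e" for e :: real
  proof -
    obtain N where N: "(1/2::real) ^ N < e"
      using real_arch_pow_inv[OF \<open>0 < e\<close>, of "1/2"] by auto
    have "(1/2::real) ^ i \<le> (1/2) ^ N" if "i \<ge> N" for i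
      using that by (intro power_decreasing) auto
    with N show ?thesis by (meson le_less_trans)
  qed
  \<comment> \<open>Beyond \<open>N\<close> all values lie below the positive value \<open>g k x\<close>, so a finite maximum decides.\<close>
  have leading_exists: "\<exists>i. leading i x" if x: "x \<in> topspace X" for x
  proof -
    obtain k where k: "0 < g k x" using pos x by blast
    obtain N where N: "\<And>j. j \<ge> N \<Longrightarrow> (1/2) ^ j < g k x"
      using small_tail[OF k] by blast
    let ?M = "Max ((\<lambda>j. g j x) ` {..max k N})"
    have "?M \<in> (\<lambda>j. g j x) ` {..max k N}"
      by (rule Max_in) auto
    then obtain i where i: "g i x = ?M" by (metis imageE)
    have le: "g j x \<le> g i x" if "j \<le> max k N" for j
      unfolding i using that by (intro Max_ge) auto
    have "g j x \<le> g i x" for j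
    proof (cases "j \<le> max k N")
      case False
      then have "g j x < g k x"
        using N[of j] bound[OF x, of j] by linarith
      then show ?thesis using le[of k] by simp
    qed (rule le)
    moreover have "0 < g i x" using k le[of k] by simp
    ultimately show ?thesis unfolding leading_def by blast
  qed
  have open_B: "openin X (B x e)" if x: "x \<in> topspace X" and e: "0 < e" for x e
  proof -
    obtain N where N: "\<And>j. j \<ge> N \<Longrightarrow> (1/2) ^ j < e"
      using small_tail[OF e] by blast
    have tail: "\<bar>g j y - g j x\<bar> < e" if "j \<ge> N" "y \<in> topspace X" for j y
      using N[OF that(1)] bound[OF that(2), of j] bound[OF x, of j] by linarith
    have eq: "B x e = (\<Inter>j\<in>{..<N}. {y \<in> topspace X. g j y \<in> {g j x - e <..< g j x + e}}) \<inter> topspace X"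
      (is "_ = ?R")
    proof (intro set_eqI iffI)
      fix y assume "y \<in> B x e"
      then show "y \<in> ?R"
        by (auto simp: B_def abs_less_iff algebra_simps)
    next
      fix y assume y: "y \<in> ?R"
      have "\<bar>g j y - g j x\<bar> < e" for j
        by (cases "j < N") (use y tail in \<open>auto simp: abs_less_iff algebra_simps\<close>)
      then show "y \<in> B x e" using y by (auto simp: B_def)
    qed
    show ?thesis unfolding eq
      by (intro openin_INT ballI openin_continuous_map_preimage[OF cont]) auto
  qed
  have "open_cover X \<V>"
    unfolding open_cover_def
  proof (intro conjI ballI equalityI subsetI)
    fix V assume "V \<in> \<V>"
    then show "openin X V" by (auto simp: \<V>_def leading_def intro!: open_B)
  next
    fix x assume "x \<in> \<Union>\<V>"
    then show "x \<in> topspace X" by (auto simp: \<V>_def B_def)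
  next
    fix x assume x: "x \<in> topspace X"
    with leading_exists obtain i where "leading i x" by blast
    moreover from this have "x \<in> B x (g i x / 8)" using x by (simp add: B_def leading_def)
    ultimately show "x \<in> \<Union>\<V>" using x by (auto simp: \<V>_def)
  qed
  moreover have "\<exists>i. St \<V> V \<subseteq> {x \<in> topspace X. 0 < g i x}" if V_in: "V \<in> \<V>" for V
  proof -
    obtain i x where V: "V = B x (g i x / 8)" and i: "leading i x"
      using V_in unfolding \<V>_def by blast
    have "w \<in> topspace X \<and> 0 < g i w" if w: "w \<in> St \<V> V" for w
    proof -
      obtain U z where U: "U \<in> \<V>" and w': "w \<in> U" and z: "z \<in> U" "z \<in> V"
        using w unfolding St_def by blast
      obtain j y where U': "U = B y (g j y / 8)"
        using U by (auto simp: \<V>_def)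
      \<comment> \<open>Put \<open>r = g i x\<close> and \<open>s = g j y\<close>. The second index compared at \<open>y\<close>, \<open>z\<close>, \<open>x\<close> gives
        \<open>s < g j x + r/8 + s/8\<close>, where \<open>g j x \<le> r\<close>, hence \<open>7 s < 9 r\<close>; the first index
        compared at \<open>x\<close>, \<open>z\<close>, \<open>y\<close>, \<open>w\<close> gives \<open>g i w > r - r/8 - s/4 > 0\<close>.\<close>
      have "\<bar>g j z - g j y\<bar> < g j y / 8" "\<bar>g j z - g j x\<bar> < g i x / 8"
           "\<bar>g i z - g i y\<bar> < g j y / 8" "\<bar>g i z - g i x\<bar> < g i x / 8"
           "\<bar>g i w - g i y\<bar> < g j y / 8"
        using z w' by (auto simp: U' V B_def)
      moreover have "g j x \<le> g i x" "0 < g i x" using i by (auto simp: leading_def)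
      ultimately have "0 < g i w" by linarith
      then show ?thesis using w' by (auto simp: U' B_def)
    qed
    then show ?thesis by blast
  qed
  ultimately show ?thesis using that by blast
qed

text \<open>
  Complete regularity provides around each point a cozero set inside a member of the cover;
  countably many of them suffice by the Lindelof property and can be enumerated, which allows the
  scaling that makes the functions vanish uniformly.
\<close>

lemma regular_Lindelof_star_refinement:
  assumes "regular_space X" and "Lindelof_space X" and U: "open_cover X \<U>"
  obtains \<V> where "open_cover X \<V>" and "\<And>V. V \<in> \<V> \<Longrightarrow> \<exists>U\<in>\<U>. St \<V> V \<subseteq> U"
proof (cases "topspace X = {}")
  case True
  then have "open_cover X {}" by (simp add: open_cover_def)
  then show ?thesis using that[of "{}"] by blast
next
  case False
  have creg: "completely_regular_space X"
    using assms by (simp add: regular_Lindelof_imp_normal_space normal_imp_completely_regular_space)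
  define bump where "bump x f U \<longleftrightarrow> continuous_map X euclideanreal f \<and>
      (\<forall>y\<in>topspace X. 0 \<le> f y \<and> f y \<le> 1) \<and> 0 < f x \<and> U \<in> \<U> \<and> {y \<in> topspace X. 0 < f y} \<subseteq> U"
    for x :: 'a and f :: "'a \<Rightarrow> real" and U
  have "\<exists>f U. bump x f U" if x: "x \<in> topspace X" for x
  proof -
    obtain U where xU: "U \<in> \<U>" "x \<in> U" "openin X U"
      using U x unfolding open_cover_def by blast
    then have "closedin X (topspace X - U)" "x \<in> topspace X - (topspace X - U)"
      using x by auto
    then obtain f where f: "continuous_map X (top_of_set {0..1::real}) f" "f x = 0"
        "f ` (topspace X - U) \<subseteq> {1}"
      using creg unfolding completely_regular_space_def by meson
    have f01: "continuous_map X euclideanreal f" "\<And>y. y \<in> topspace X \<Longrightarrow> 0 \<le> f y \<and> f y \<le> 1"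
      using f(1) by (auto simp: continuous_map_in_subtopology image_subset_iff Pi_iff)
    show ?thesis unfolding bump_def
    proof (intro exI conjI)
      show "continuous_map X euclideanreal (\<lambda>y. 1 - f y)"
        using f01(1) by (intro continuous_intros) auto
      show "U \<in> \<U>" by (rule xU)
      show "{y \<in> topspace X. 0 < 1 - f y} \<subseteq> U" using f(3) by fastforce
    qed (use f(2) f01(2) in auto)
  qed
  then obtain f h where fh: "\<And>x. x \<in> topspace X \<Longrightarrow> bump x (f x) (h x)"
    by metis
  have f: "continuous_map X euclideanreal (f x) \<and>
      (\<forall>y\<in>topspace X. 0 \<le> f x y \<and> f x y \<le> 1) \<and> 0 < f x x \<and> h x \<in> \<U> \<and>
      {y \<in> topspace X. 0 < f x y} \<subseteq> h x" if "x \<in> topspace X" for x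
    using fh[OF that] unfolding bump_def .
  define coz where "coz x = {y \<in> topspace X. f x y \<in> {0<..}}" for x
  have open_coz: "openin X (coz x)" if "x \<in> topspace X" for x
    unfolding coz_def using f[OF that] by (intro openin_continuous_map_preimage) auto
  have mem_coz: "x \<in> coz x" if "x \<in> topspace X" for x
    using f[OF that] that by (simp add: coz_def)
  have Union_coz: "\<Union>(coz ` topspace X) = topspace X"
  proof
    show "\<Union>(coz ` topspace X) \<subseteq> topspace X" by (simp add: UN_least coz_def)
    show "topspace X \<subseteq> \<Union>(coz ` topspace X)" by (meson UN_I mem_coz subsetI)
  qed
  have "\<exists>\<C>. countable \<C> \<and> \<C> \<subseteq> coz ` topspace X \<and> \<Union>\<C> = topspace X"
    by (rule Lindelof_spaceD[OF assms(2) _ Union_coz]) (elim imageE, simp add: open_coz)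
  then obtain \<C> where C: "countable \<C>" "\<C> \<subseteq> coz ` topspace X" "\<Union>\<C> = topspace X"
    by (elim exE conjE)
  then obtain P where P: "countable P" "P \<subseteq> topspace X" "\<C> = coz ` P"
    using countable_subset_image[of \<C> coz "topspace X"] by metis
  have "P \<noteq> {}" using C(3) P(3) False by (metis Union_empty image_empty)
  define p where "p = from_nat_into P"
  have p: "p i \<in> topspace X" for i
    unfolding p_def by (rule subsetD[OF P(2) from_nat_into[OF \<open>P \<noteq> {}\<close>]])
  have range_p: "range p = P"
    unfolding p_def by (rule range_from_nat_into[OF \<open>P \<noteq> {}\<close> P(1)])
  define g where "g i y = (1/2) ^ i * f (p i) y" for i y
  obtain \<V> where V: "open_cover X \<V>"
    and star: "\<And>V. V \<in> \<V> \<Longrightarrow> \<exists>i. St \<V> V \<subseteq> {x \<in> topspace X. 0 < g i x}"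
  proof (rule star_refinement_of_vanishing_functions)
    show "continuous_map X euclideanreal (g i)" for i
      unfolding g_def using f[OF p] by (intro continuous_map_real_mult_left) auto
    show "0 \<le> g i x \<and> g i x \<le> (1/2) ^ i" if "x \<in> topspace X" for i x
      using f[OF p, of i] that by (auto simp: g_def mult_left_le)
    show "\<exists>i. 0 < g i x" if x: "x \<in> topspace X" for x
    proof -
      obtain q where "q \<in> P" "x \<in> coz q" using C(3) P(3) x by blast
      then obtain i where "q = p i" using range_p by blast
      then have "0 < g i x" using \<open>x \<in> coz q\<close> by (simp add: coz_def g_def)
      then show ?thesis ..
    qed
  qed (rule that)
  have "\<exists>U\<in>\<U>. St \<V> V \<subseteq> U" if V_in: "V \<in> \<V>" for V
  proof -
    obtain i where "St \<V> V \<subseteq> {x \<in> topspace X. 0 < g i x}"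
      using star[OF V_in] by (elim exE)
    also have "\<dots> = {x \<in> topspace X. 0 < f (p i) x}" by (simp add: g_def zero_less_mult_iff)
    also have "\<dots> \<subseteq> h (p i)" using f[OF p, of i] by (elim conjE)
    finally show ?thesis using f[OF p, of i] by (intro bexI[of _ "h (p i)"]) simp_all
  qed
  with V show ?thesis by (rule that)
qed

text \<open>
  Stars commute with unions, so star refinement of single members gives the one-step hypothesis
  of the iteration lemma for finite families.
\<close>

lemma regular_Lindelof_finite_star_refinement:
  assumes "regular_space X" and "Lindelof_space X" and "open_cover X \<U>"
  shows "\<exists>\<V>. open_cover X \<V> \<and> (\<forall>V\<in>\<V>. \<exists>U\<in>\<U>. V \<subseteq> U) \<and>
           (\<forall>\<C>\<subseteq>\<V>. finite \<C> \<longrightarrow> (\<exists>\<D>\<subseteq>\<U>. finite \<D> \<and> St \<V> (\<Union>\<C>) \<subseteq> \<Union>\<D>))"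
proof -
  obtain \<V> where V: "open_cover X \<V>" and "\<And>V. V \<in> \<V> \<Longrightarrow> \<exists>U\<in>\<U>. St \<V> V \<subseteq> U"
    using regular_Lindelof_star_refinement[OF assms] by blast
  then obtain h where h: "\<And>V. V \<in> \<V> \<Longrightarrow> h V \<in> \<U> \<and> St \<V> V \<subseteq> h V"
    by metis
  have "V \<subseteq> h V" if "V \<in> \<V>" for V
    using h[OF that] subset_St[OF V, of V] open_cover_subset_topspace[OF V, of "{V}"] that by auto
  then have "\<forall>V\<in>\<V>. \<exists>U\<in>\<U>. V \<subseteq> U" using h by blast
  moreover have "\<exists>\<D>\<subseteq>\<U>. finite \<D> \<and> St \<V> (\<Union>\<C>) \<subseteq> \<Union>\<D>" if "\<C> \<subseteq> \<V>" "finite \<C>" for \<C>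
    by (rule exI[of _ "h ` \<C>"]) (use h that in \<open>auto simp: St_Union\<close>)
  ultimately show ?thesis using V by blast
qed

section \<open>The selection principles\<close>

text \<open>
  The \<open>m\<close>-th cover is replaced by one for which the \<open>n\<close>-fold star of a finite union lies in
  a finite union of members of the original cover; the \<open>n\<close>-star-Menger selections from the new
  covers then translate into Menger selections from the old ones.
\<close>

lemma regular_Lindelof_star_Menger_imp_Menger:
  assumes "regular_space X" and "Lindelof_space X" and "star_Menger_space n X"
  shows "Menger_space X"
  unfolding Menger_space_def
proof (intro allI impI)
  fix \<U> :: "nat \<Rightarrow> 'a set set"
  assume U: "\<forall>m. open_cover X (\<U> m)"
  have "\<forall>m. \<exists>\<V>. open_cover X \<V> \<and>
      (\<forall>\<C>\<subseteq>\<V>. finite \<C> \<longrightarrow> (\<exists>\<D>\<subseteq>\<U> m. finite \<D> \<and> (St \<V> ^^ n) (\<Union>\<C>) \<subseteq> \<Union>\<D>))"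
    using iterated_stars_under_small_unions
      [OF regular_Lindelof_finite_star_refinement[OF assms(1,2)] U[rule_format], where k = n]
    by (intro allI)
  then obtain \<W> where W: "\<forall>m. open_cover X (\<W> m)"
    and star: "\<And>m \<C>. \<C> \<subseteq> \<W> m \<Longrightarrow> finite \<C> \<Longrightarrow>
      \<exists>\<D>\<subseteq>\<U> m. finite \<D> \<and> (St (\<W> m) ^^ n) (\<Union>\<C>) \<subseteq> \<Union>\<D>"
    by metis
  obtain \<F> where F: "\<And>m. finite (\<F> m) \<and> \<F> m \<subseteq> \<W> m"
    and cover: "(\<Union>m. (St (\<W> m) ^^ n) (\<Union>(\<F> m))) = topspace X"
    using assms(3) W unfolding star_Menger_space_def by meson
  have "\<forall>m. \<exists>\<D>\<subseteq>\<U> m. finite \<D> \<and> (St (\<W> m) ^^ n) (\<Union>(\<F> m)) \<subseteq> \<Union>\<D>"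
    using star[OF conjunct2[OF F] conjunct1[OF F]] by blast
  then obtain \<D> where D: "\<And>m. \<D> m \<subseteq> \<U> m \<and> finite (\<D> m) \<and> (St (\<W> m) ^^ n) (\<Union>(\<F> m)) \<subseteq> \<Union>(\<D> m)"
    by metis
  have "(\<Union>m. \<Union>(\<D> m)) = topspace X"
  proof
    show "(\<Union>m. \<Union>(\<D> m)) \<subseteq> topspace X"
      by (intro UN_least open_cover_subset_topspace[OF U[rule_format]]) (use D in auto)
    show "topspace X \<subseteq> (\<Union>m. \<Union>(\<D> m))"
      unfolding cover[symmetric] by (intro UN_mono) (use D in auto)
  qed
  then show "\<exists>\<V>. (\<forall>m. finite (\<V> m) \<and> \<V> m \<subseteq> \<U> m) \<and> (\<Union>m. \<Union>(\<V> m)) = topspace X"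
    by (intro exI[of _ \<D>] conjI allI) (use D in auto)
qed

text \<open>
  A point chosen in a member \<open>V\<close> of a cover has \<open>V\<close> inside its first star, and further stars
  only grow. At least one star is required: a space covered by countably many finite sets is
  countable.
\<close>

lemma Menger_imp_strongly_star_Menger:
  assumes "Menger_space X" and "k \<ge> 1"
  shows "strongly_star_Menger_space k X"
  unfolding strongly_star_Menger_space_def
proof (intro allI impI)
  fix \<U> :: "nat \<Rightarrow> 'a set set"
  assume U: "\<forall>m. open_cover X (\<U> m)"
  then obtain \<V> where V: "\<And>m. finite (\<V> m) \<and> \<V> m \<subseteq> \<U> m" and cover: "(\<Union>m. \<Union>(\<V> m)) = topspace X"
    using assms(1) unfolding Menger_space_def by meson
  \<comment> \<open>The empty set may be a member of a cover and contains no point to choose.\<close>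
  define F where "F m = (\<lambda>V. SOME x. x \<in> V) ` (\<V> m - {{}})" for m
  have F: "finite (F m) \<and> F m \<subseteq> topspace X" for m
  proof
    show "finite (F m)" using V by (simp add: F_def)
    have "F m \<subseteq> \<Union>(\<V> m)" by (auto simp: F_def some_in_eq)
    also have "\<dots> \<subseteq> topspace X"
      using open_cover_subset_topspace[OF U[rule_format]] conjunct2[OF V] .
    finally show "F m \<subseteq> topspace X" .
  qed
  have "\<Union>(\<V> m) \<subseteq> (St (\<U> m) ^^ k) (F m)" for m
  proof -
    have "V \<subseteq> St (\<U> m) (F m)" if "V \<in> \<V> m" for V
    proof (cases "V = {}")
      case False
      then have "(SOME x. x \<in> V) \<in> V \<inter> F m"
        using that by (auto simp: F_def some_in_eq)
      then show ?thesis using V that unfolding St_def by blast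
    qed simp
    then show ?thesis
      using St_subset_funpow_St[OF U[rule_format] conjunct2[OF F] assms(2), of m] by blast
  qed
  then have "topspace X \<subseteq> (\<Union>m. (St (\<U> m) ^^ k) (F m))"
    unfolding cover[symmetric] by blast
  moreover have "(\<Union>m. (St (\<U> m) ^^ k) (F m)) \<subseteq> topspace X"
    by (intro UN_least funpow_St_subset_topspace U[rule_format]) (use F in auto)
  ultimately show "\<exists>F. (\<forall>m. finite (F m) \<and> F m \<subseteq> topspace X) \<and>
      (\<Union>m. (St (\<U> m) ^^ k) (F m)) = topspace X"
    using F by blast
qed

lemma strongly_star_Menger_imp_star_Menger:
  assumes "strongly_star_Menger_space k X"
  shows "star_Menger_space k X"
  unfolding star_Menger_space_def
proof (intro allI impI)
  fix \<U> :: "nat \<Rightarrow> 'a set set"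
  assume U: "\<forall>m. open_cover X (\<U> m)"
  then obtain F where F: "\<And>m. finite (F m) \<and> F m \<subseteq> topspace X"
    and cover: "(\<Union>m. (St (\<U> m) ^^ k) (F m)) = topspace X"
    using assms unfolding strongly_star_Menger_space_def by meson
  have "\<forall>m. \<forall>x\<in>topspace X. \<exists>V\<in>\<U> m. x \<in> V"
    using U unfolding open_cover_def by blast
  then obtain h where h: "\<And>m x. x \<in> topspace X \<Longrightarrow> h m x \<in> \<U> m \<and> x \<in> h m x"
    by metis
  define \<V> where "\<V> m = h m ` F m" for m
  have V: "finite (\<V> m) \<and> \<V> m \<subseteq> \<U> m" for m
    using F h by (auto simp: \<V>_def)
  have "F m \<subseteq> \<Union>(\<V> m)" for m
    using F h by (fastforce simp: \<V>_def)
  then have "topspace X \<subseteq> (\<Union>m. (St (\<U> m) ^^ k) (\<Union>(\<V> m)))"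
    unfolding cover[symmetric] by (intro UN_mono funpow_St_mono) auto
  moreover have "(\<Union>m. (St (\<U> m) ^^ k) (\<Union>(\<V> m))) \<subseteq> topspace X"
    by (rule UN_least, rule funpow_St_subset_topspace[OF U[rule_format]])
      (rule open_cover_subset_topspace[OF U[rule_format] conjunct2[OF V]])
  ultimately show "\<exists>\<V>. (\<forall>m. finite (\<V> m) \<and> \<V> m \<subseteq> \<U> m) \<and>
      (\<Union>m. (St (\<U> m) ^^ k) (\<Union>(\<V> m))) = topspace X"
    using V by blast
qed

theorem theorem3p11:
  fixes X :: "'a topology" and n :: nat
  assumes "regular_space X" and "t1_space X"
    and "paraLindelof_space X"
    and "n \<ge> 1"
  shows "(star_Menger_space n X \<longleftrightarrow> strongly_star_Menger_space n X) \<and>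
         (strongly_star_Menger_space n X \<longleftrightarrow> Menger_space X)"
proof -
  have "Menger_space X" if star: "star_Menger_space n X"
    using assms(1) paraLindelof_star_Menger_imp_Lindelof[OF assms(3) star] star
    by (rule regular_Lindelof_star_Menger_imp_Menger)
  moreover have "strongly_star_Menger_space n X" if "Menger_space X"
    using that assms(4) by (rule Menger_imp_strongly_star_Menger)
  moreover have "star_Menger_space n X" if "strongly_star_Menger_space n X"
    using that by (rule strongly_star_Menger_imp_star_Menger)
  ultimately show ?thesis by argo
qed

end
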